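(* Let $c_1>0$ be a constant, let $(t_n)$ be a sequence with $t_n\le\frac12$ and $\frac{t_n}{(\ln n)^3/n}\to\infty$ as $n\to\infty$, and let $K=K_n$ satisfy $K\asymp\ln n$ (i.e. $K/\ln n$ is bounded above and bounded away from $0$). Let $$U'=\bigcup_{x\in[\frac{c_1\ln n}{n},\,t_n]}U(x;c_1)\times U(x;c_1).$$ Then $$\liminf_{n\to\infty}\ \sqrt{n\ln n}\cdot\inf_{P\in\mathrm{poly}_K^2}\ \sup_{(x,y)\in U',\,x+y>0}\frac{\big|P(x,y)-|x-y|\big|}{\sqrt{x+y}}=+\infty .$$
   Context: $\mathrm{poly}_K^2$ is the set of real bivariate polynomials of degree at most $K$ in each variable. For $q\in[0,1]$, $U(q;c_1)=[0,\frac{2c_1\ln n}{n}]$ if $q\le\frac{c_1\ln n}{n}$, and $U(q;c_1)=\big[q-\sqrt{\tfrac{c_1q\ln n}{n}},\,q+\sqrt{\tfrac{c_1q\ln n}{n}}\big]$ if $\frac{c_1\ln n}{n}<q\le1$. Logarithms are natural. *)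

theory Defs
  imports "HOL-Analysis.Analysis" "HOL-Library.Landau_Symbols"
begin

text \<open>
  Real polynomials in two variables, of degree at most \<open>K\<close> in each variable, represented by
  the functions they induce (over the infinite field of reals this loses no information).
\<close>
definition poly2_upto :: "nat \<Rightarrow> (real \<Rightarrow> real \<Rightarrow> real) set" where
  "poly2_upto K =
     {P. \<exists>a :: nat \<Rightarrow> nat \<Rightarrow> real. P = (\<lambda>x y. \<Sum>i\<le>K. \<Sum>j\<le>K. a i j * x ^ i * y ^ j)}"

text \<open>Intended for \<open>n \<ge> 1\<close> and \<open>q \<in> {0..1}\<close> only.\<close>
definition U :: "nat \<Rightarrow> real \<Rightarrow> real \<Rightarrow> real set" where
  "U n c1 q =
     (if q \<le> c1 * ln (real n) / real n
      then {0 .. 2 * c1 * ln (real n) / real n}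
      else {q - sqrt (c1 * q * ln (real n) / real n) .. q + sqrt (c1 * q * ln (real n) / real n)})"

definition U' :: "nat \<Rightarrow> real \<Rightarrow> real \<Rightarrow> (real \<times> real) set" where
  "U' n c1 t = (\<Union>x\<in>{c1 * ln (real n) / real n .. t}. U n c1 x \<times> U n c1 x)"

text \<open>
  The value is taken in the extended reals because the supremum can be infinite (for instance,
  whenever \<open>P 0 0 \<noteq> 0\<close> and \<open>(0, 0)\<close> is an accumulation point of the region).
\<close>
definition weighted_approx_error :: "(real \<times> real) set \<Rightarrow> (real \<Rightarrow> real \<Rightarrow> real) \<Rightarrow> ereal" where
  "weighted_approx_error S P =
     (SUP (x, y) \<in> {(x, y). (x, y) \<in> S \<and> x + y > 0}.
        ereal (\<bar>P x y - \<bar>x - y\<bar>\<bar> / sqrt (x + y)))"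

end

theory Submission
  imports Defs "HOL-Computational_Algebra.Polynomial"
begin

text \<open>
  Put \<open>\<Delta> = c\<^sub>1 ln n / n\<close> and \<open>x = \<Delta> (s + u)\<close>, \<open>y = \<Delta> (s - u)\<close>. The region then contains the scaled
  points with \<open>1 < s \<le> t/\<Delta>\<close> and \<open>u\<^sup>2 \<le> s\<close>, the function \<open>\<bar>x - y\<bar>\<close> becomes \<open>2 \<Delta> \<bar>u\<bar>\<close>, and an error
  \<open>M / sqrt (n ln n)\<close> in the weighted norm says that a function \<open>F u s\<close>, polynomial of degree at most
  \<open>2 K\<close> in each variable, satisfies \<open>\<bar>F u s - \<bar>u\<bar>\<bar> \<le> \<epsilon> sqrt s\<close> with \<open>\<epsilon>\<close> of order \<open>M / ln n\<close>, hence
  of order \<open>M / K\<close>. On each single line \<open>s = const\<close> such an approximation of \<open>\<bar>u\<bar>\<close> exists. What makes it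
  impossible on the whole region is that \<open>T = t/\<Delta>\<close> is much larger than \<open>K\<^sup>2\<close>: a polynomial of degree
  \<open>O(K)\<close> in \<open>s\<close> on an interval of length \<open>T\<close> cannot vary much over lengths below \<open>T/K\<^sup>2\<close>, so the
  behaviour of \<open>F\<close> at \<open>s = 2\<close> is tied to that at \<open>s\<close> of order \<open>V\<^sup>2 = T/(64 K\<^sup>2)\<close>, where \<open>V\<close> is large.

  Precisely, for fixed \<open>u\<close> with \<open>\<bar>u\<bar> \<le> V\<close> the bound \<open>\<epsilon> sqrt s\<close> is available for \<open>V\<^sup>2 \<le> s \<le> T\<close>. It
  extrapolates to \<open>s = 2\<close> with error \<open>O(\<epsilon> V)\<close> (\<open>poly_weighted_extrapolate\<close>). Thus the polynomial
  \<open>u \<mapsto> F u 2\<close> approximates \<open>\<bar>u\<bar>\<close> on the long interval \<open>[-V, V]\<close> with error \<open>O(\<epsilon> V)\<close>, and on the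
  short interval \<open>[-1, 1]\<close> with the much smaller error \<open>O(\<epsilon>)\<close>. After rescaling by \<open>V\<close> and
  passing to \<open>w = u\<^sup>2\<close>, the even part becomes a polynomial of degree at most \<open>K\<close> that approximates
  \<open>sqrt w\<close> on \<open>[0, 1]\<close> with error \<open>O(\<epsilon>)\<close> and near \<open>0\<close> with error \<open>O(\<epsilon>/V)\<close>. But the product of these two
  errors is at least of order \<open>1/K\<^sup>2\<close> (\<open>sqrt_approx_global_local\<close>), whence \<open>V = O((K \<epsilon>)\<^sup>2) = O(M\<^sup>2)\<close>.
  This fails for large \<open>n\<close> because \<open>V \<rightarrow> \<infinity>\<close>.

  Both polynomial estimates rest on one tool, the growth bound \<open>poly_extrapolate_left\<close>: a polynomial of
  degree \<open>d\<close> at most doubles its supremum when an interval is enlarged by a fraction \<open>1/(4 d\<^sup>2)\<close> of its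
  length.
\<close>

section \<open>Chebyshev polynomials on the unit interval\<close>

text \<open>
  These are \<open>T\<^sub>k (1 - 2 z)\<close> for the classical Chebyshev polynomials \<open>T\<^sub>k\<close>. With this normalisation they
  oscillate on \<open>[0, 1]\<close>, equal \<open>1\<close> at \<open>0\<close>, and grow to the left of \<open>0\<close>, which is the side to which all
  extrapolations below are made.
\<close>
fun cheb :: "nat \<Rightarrow> real poly" where
  "cheb 0 = 1"
| "cheb (Suc 0) = [:1, -2:]"
| "cheb (Suc (Suc k)) = [:2, -4:] * cheb (Suc k) - cheb k"

lemma degree_cheb: "degree (cheb k) \<le> k"
proof (induction k rule: cheb.induct)
  case (3 k)
  have "degree ([:2, -4:] * cheb (Suc k)) \<le> Suc (Suc k)"
    using degree_mult_le[of "[:2, -4::real:]" "cheb (Suc k)"] 3 by simp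
  with 3 show ?case by (auto intro: degree_diff_le)
qed auto

lemma poly_cheb_sin: "poly (cheb k) ((sin x)\<^sup>2) = cos (2 * real k * x)"
proof (induction k rule: cheb.induct)
  case 2
  show ?case by (simp add: cos_double_sin)
next
  case (3 k)
  have "cos (2 * real (Suc (Suc k)) * x) + cos (2 * real k * x)
      = 2 * cos (2 * x) * cos (2 * real (Suc k) * x)"
    using cos_plus_cos[of "2 * real (Suc (Suc k)) * x" "2 * real k * x"]
    by (simp add: algebra_simps add_divide_distrib diff_divide_distrib)
  moreover have "poly (cheb (Suc (Suc k))) ((sin x)\<^sup>2)
      = 2 * cos (2 * x) * cos (2 * real (Suc k) * x) - cos (2 * real k * x)"
    using 3 unfolding cos_double_sin[of x] by (simp add: algebra_simps del: of_nat_Suc)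
  ultimately show ?case by simp
qed auto

lemma poly_cheb_sinh: "poly (cheb k) (- (sinh x)\<^sup>2) = cosh (2 * real k * x)"
proof (induction k rule: cheb.induct)
  case 2
  show ?case by (simp add: cosh_double cosh_square_eq)
next
  case (3 k)
  have "cosh (2 * real (Suc k) * x + 2 * x) + cosh (2 * real (Suc k) * x - 2 * x)
      = 2 * cosh (2 * x) * cosh (2 * real (Suc k) * x)"
    unfolding cosh_add cosh_diff by simp
  moreover have "2 * real (Suc k) * x + 2 * x = 2 * real (Suc (Suc k)) * x"
    "2 * real (Suc k) * x - 2 * x = 2 * real k * x"
    by (simp_all add: algebra_simps)
  ultimately have "cosh (2 * real (Suc (Suc k)) * x) + cosh (2 * real k * x)
      = 2 * cosh (2 * x) * cosh (2 * real (Suc k) * x)" by simp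
  moreover have "poly (cheb (Suc (Suc k))) (- (sinh x)\<^sup>2)
      = 2 * cosh (2 * x) * cosh (2 * real (Suc k) * x) - cosh (2 * real k * x)"
    using 3 unfolding cosh_double[of x] cosh_square_eq[of x]
    by (simp add: algebra_simps del: of_nat_Suc)
  ultimately show ?case by simp
qed auto

lemma abs_cheb_le_1:
  assumes "0 \<le> z" "z \<le> 1"
  shows "\<bar>poly (cheb k) z\<bar> \<le> 1"
proof -
  have "(sin (arcsin (sqrt z)))\<^sup>2 = z"
    using assms real_sqrt_le_1_iff by (subst sin_arcsin) (auto intro: order_trans[of _ 0])
  with poly_cheb_sin[of k "arcsin (sqrt z)"] show ?thesis by simp
qed

lemma coeff_cheb_0: "coeff (cheb k) 0 = 1"
  by (induction k rule: cheb.induct) auto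

text \<open>
  Being of exact order \<open>k\<^sup>2\<close>, the slope at \<open>0\<close> makes \<open>(1 - cheb k z) / (2 k\<^sup>2 z)\<close> a Fejer-type kernel:
  its value at \<open>0\<close> is \<open>1\<close>, and elsewhere it is at most \<open>1 / (k\<^sup>2 z)\<close>.
\<close>
lemma coeff_cheb_1: "coeff (cheb k) 1 = - 2 * (real k)\<^sup>2"
  by (induction k rule: cheb.induct) (auto simp: coeff_cheb_0 power2_eq_square algebra_simps)

lemma cheb_ge_1_left:
  assumes "x \<ge> 0"
  shows "poly (cheb k) (- x) \<ge> 1"
  using assms poly_cheb_sinh[of k "arsinh (sqrt x)"] cosh_real_ge_1 by simp

text \<open>
  For \<open>x = sinh\<^sup>2 a\<close> the value is \<open>cosh (2 k a)\<close>, and \<open>a \<le> sinh a = sqrt x\<close> gives \<open>2 k a \<le> 1\<close>,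
  where \<open>cosh\<close> is below \<open>2\<close>.
\<close>
lemma cheb_le_2_left:
  assumes "x \<ge> 0" "4 * (real k)\<^sup>2 * x \<le> 1"
  shows "poly (cheb k) (- x) \<le> 2"
proof -
  define a where "a = arsinh (sqrt x)"
  have "a \<ge> 0" using assms by (simp add: a_def le_less)
  have "sinh 0 + a \<le> sinh a"
  proof (cases "a = 0")
    case False
    with \<open>a \<ge> 0\<close> have "a > 0" by simp
    then have "\<exists>z>0. z < a \<and> sinh a - sinh 0 = (a - 0) * cosh z"
      by (intro MVT2) (auto intro!: derivative_eq_intros)
    then obtain z where "sinh a = a * cosh z" by auto
    with cosh_real_ge_1[of z] \<open>a \<ge> 0\<close> mult_left_mono[of 1 "cosh z" a] show ?thesis by simp
  qed simp
  then have "a \<le> sqrt x" by (simp add: a_def)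
  have "(2 * real k * sqrt x)\<^sup>2 \<le> 1\<^sup>2"
    using assms by (simp add: power_mult_distrib)
  then have "2 * real k * sqrt x \<le> 1" by (rule power2_le_imp_le) simp
  moreover have "2 * real k * a \<le> 2 * real k * sqrt x"
    using \<open>a \<le> sqrt x\<close> by (intro mult_left_mono) auto
  ultimately have "2 * real k * a \<le> 1" by linarith
  then have "cosh (2 * real k * a) \<le> cosh (1::real)"
    using \<open>a \<ge> 0\<close> by (subst cosh_real_nonneg_le_iff) auto
  also have "cosh (1::real) \<le> 2"
  proof -
    have "exp (- 1 :: real) \<le> 1" by simp
    then have "exp 1 + exp (- 1 :: real) \<le> 4" using exp_le by linarith
    then show ?thesis by (simp add: cosh_field_def)
  qed
  finally show ?thesis
    using poly_cheb_sinh[of k a] assms by (simp add: a_def)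
qed

section \<open>Growth of polynomials outside an interval\<close>

text \<open>
  Extremality of Chebyshev polynomials by counting zeros. If \<open>p\<close> exceeded the bound at \<open>x\<close>, subtract from
  \<open>cheb d\<close> the multiple of \<open>p\<close> that agrees with it at \<open>x\<close>. This multiple is smaller than \<open>1\<close> in modulus on \<open>[0, 1]\<close>, so
  the difference keeps the alternating signs of \<open>cheb d\<close> at its \<open>d + 1\<close> extremal points; the resulting \<open>d\<close>
  zeros in \<open>(0, 1)\<close>, together with \<open>x\<close>, are too many for degree \<open>d\<close>.
\<close>
lemma cheb_dominates_left:
  fixes p :: "real poly"
  assumes deg: "degree p \<le> d"
    and bound: "\<And>z. 0 \<le> z \<Longrightarrow> z \<le> 1 \<Longrightarrow> \<bar>poly p z\<bar> \<le> B"
    and x: "x < 0"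
  shows "\<bar>poly p x\<bar> \<le> B * poly (cheb d) x"
proof -
  have *: "poly g x \<le> B * poly (cheb d) x"
    if deg: "degree g \<le> d" and bound: "\<And>z. 0 \<le> z \<Longrightarrow> z \<le> 1 \<Longrightarrow> \<bar>poly g z\<bar> \<le> B"
    for g :: "real poly"
  proof (rule ccontr)
    assume "\<not> poly g x \<le> B * poly (cheb d) x"
    then have less: "B * poly (cheb d) x < poly g x" by simp
    have C: "poly (cheb d) x \<ge> 1" using cheb_ge_1_left[of "- x" d] x by simp
    have B: "B \<ge> 0" using bound[of 0] by simp
    have gpos: "poly g x > 0"
      using less mult_nonneg_nonneg[of B "poly (cheb d) x"] B C by linarith
    define l where "l = poly (cheb d) x / poly g x"
    have l: "l > 0" "l * B < 1"
      using gpos C less by (auto simp: l_def field_simps)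
    define f where "f = cheb d - smult l g"
    have fx: "poly f x = 0" using gpos by (simp add: f_def l_def)
    have degf: "degree f \<le> d"
      unfolding f_def using deg degree_cheb
      by (intro degree_diff_le) (auto intro: order_trans[OF degree_smult_le])
    \<comment> \<open>The extremal points of \<open>cheb d\<close>; for \<open>d = 0\<close> division by zero leaves the single point \<open>0\<close>.\<close>
    define node where "node j = (sin (real j * pi / (2 * real d)))\<^sup>2" for j
    have node01: "0 \<le> node j" "node j \<le> 1" for j
      unfolding node_def by (auto simp: abs_square_le_1)
    have sgn_f: "(- 1) ^ j * poly f (node j) > 0" if "j \<le> d" for j
    proof -
      have "poly (cheb d) (node j) = (- 1) ^ j"
      proof (cases "d = 0")
        case False
        then show ?thesis unfolding node_def poly_cheb_sin by (simp add: mult.commute)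
      qed (use that in \<open>simp\<close>)
      then have "(- 1) ^ j * poly f (node j) = 1 - (- 1) ^ j * (l * poly g (node j))"
        by (simp add: f_def right_diff_distrib flip: power_add mult_2)
      moreover have "\<bar>(- 1) ^ j * (l * poly g (node j))\<bar> \<le> l * B"
        using bound[OF node01] l by (simp add: abs_mult mult_left_mono)
      ultimately show ?thesis using l by linarith
    qed
    have node_less: "node j < node (Suc j)" if "j < d" for j
    proof -
      have "real (Suc j) * pi \<le> real d * pi" using that by (intro mult_right_mono) auto
      then have "sin (real j * pi / (2 * real d)) < sin (real (Suc j) * pi / (2 * real d))"
        using that pi_gt_zero
        by (intro sin_monotone_2pi)
          (auto simp: field_simps intro: order_trans[of _ 0])
      moreover have "sin (real j * pi / (2 * real d)) \<ge> 0"
        using that by (intro sin_ge_zero) (auto simp: field_simps)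
      ultimately show ?thesis unfolding node_def by (intro power_strict_mono) auto
    qed
    have "\<exists>r. node j < r \<and> r < node (Suc j) \<and> poly f r = 0" if "j < d" for j
    proof (rule poly_IVT)
      have "((- 1) ^ j * poly f (node j)) * ((- 1) ^ Suc j * poly f (node (Suc j))) > 0"
        using that by (intro mult_pos_pos[OF sgn_f sgn_f]) auto
      then show "poly f (node j) * poly f (node (Suc j)) < 0"
        by (cases "even j") auto
    qed (use node_less that in auto)
    then obtain r where r: "\<And>j. j < d \<Longrightarrow> node j < r j \<and> r j < node (Suc j) \<and> poly f (r j) = 0"
      by metis
    have node_mono: "node i \<le> node j" if "i \<le> j" "j \<le> d" for i j
      using that
    proof (induction j rule: dec_induct)
      case (step m)
      then show ?case using node_less[of m] by simp
    qed simp
    have r_less: "r i < r j" if "i < j" "j < d" for i j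
      using r[of i] r[of j] node_mono[of "Suc i" j] that by force
    have "inj_on r {..<d}"
    proof (rule inj_onI)
      fix i j assume "i \<in> {..<d}" "j \<in> {..<d}" "r i = r j"
      then show "i = j" using r_less[of i j] r_less[of j i] by (cases i j rule: linorder_cases) auto
    qed
    moreover have "x \<notin> r ` {..<d}"
    proof
      assume "x \<in> r ` {..<d}"
      then obtain j where "j < d" "x = r j" by auto
      then show False using r[of j] node01(1)[of j] x by simp
    qed
    ultimately have card: "card (insert x (r ` {..<d})) = Suc d"
      by (simp add: card_image)
    have "f \<noteq> 0" using sgn_f[of 0] by auto
    then have "card (insert x (r ` {..<d})) \<le> card {z. poly f z = 0}"
      using r fx by (intro card_mono poly_roots_finite) auto
    also have "\<dots> \<le> degree f" using \<open>f \<noteq> 0\<close> by (rule card_poly_roots_bound)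
    finally show False using card degf by simp
  qed
  from *[of p] *[of "- p"] deg bound show ?thesis by (simp add: abs_le_iff)
qed

lemma poly_extrapolate_left:
  fixes p :: "real poly"
  assumes deg: "degree p \<le> d" and ab: "a < b"
    and bound: "\<And>z. a \<le> z \<Longrightarrow> z \<le> b \<Longrightarrow> \<bar>poly p z\<bar> \<le> B"
    and x: "x \<le> a" "4 * (real d)\<^sup>2 * (a - x) \<le> b - a"
  shows "\<bar>poly p x\<bar> \<le> 2 * B"
proof (cases "x = a")
  case True
  then show ?thesis using bound[of a] ab by simp
next
  case False
  define g where "g = pcompose p [:a, b - a:]"
  define y where "y = (x - a) / (b - a)"
  have y: "y < 0" using False x ab by (simp add: y_def divide_less_0_iff)
  have "degree g \<le> d"
    using deg ab by (simp add: g_def degree_pcompose)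
  moreover have "\<bar>poly g z\<bar> \<le> B" if "0 \<le> z" "z \<le> 1" for z
  proof -
    have "z * (b - a) \<le> b - a" using that ab by (intro mult_left_le_one_le) auto
    then have "a + z * (b - a) \<le> b" by linarith
    then have "\<bar>poly p (a + z * (b - a))\<bar> \<le> B" using that ab by (intro bound) auto
    then show ?thesis by (simp add: g_def poly_pcompose)
  qed
  ultimately have "\<bar>poly g y\<bar> \<le> B * poly (cheb d) y"
    using y by (rule cheb_dominates_left)
  moreover have "poly (cheb d) y \<le> 2"
    using cheb_le_2_left[of "- y" d] y x ab by (simp add: y_def field_simps)
  moreover have "B \<ge> 0" using bound[of a] ab by simp
  ultimately have "\<bar>poly g y\<bar> \<le> B * 2" by (meson mult_left_mono order_trans)
  moreover have "poly g y = poly p x" using ab by (simp add: g_def y_def poly_pcompose)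
  ultimately show ?thesis by simp
qed

text \<open>
  A substitute for Markov's inequality at an endpoint: if \<open>q w - q 0 = w * Q w\<close>, then it bounds the
  difference quotient of \<open>q\<close> by \<open>d\<^sup>2\<close> times the oscillation of \<open>q\<close>. Dividing by \<open>w\<close> loses a factor \<open>O(d\<^sup>2)\<close>
  as long as \<open>w \<ge> 1/(5 d\<^sup>2)\<close>, and the remaining gap next to \<open>0\<close> is short enough for extrapolation.
\<close>
lemma poly_lipschitz_at_0:
  fixes Q :: "real poly"
  assumes d: "d \<ge> 1" and deg: "degree Q \<le> d"
    and bound: "\<And>w. 0 \<le> w \<Longrightarrow> w \<le> 1 \<Longrightarrow> \<bar>w * poly Q w\<bar> \<le> B"
    and w: "0 \<le> w" "w \<le> 1"
  shows "\<bar>poly Q w\<bar> \<le> 10 * (real d)\<^sup>2 * B"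
proof -
  define a where "a = 1 / (5 * (real d)\<^sup>2)"
  have d2: "(real d)\<^sup>2 \<ge> 1" using d by simp
  have a: "0 < a" "a \<le> 1 / 5" using d d2 by (auto simp: a_def field_simps)
  have B: "B \<ge> 0" using bound[of 0] by simp
  have far: "\<bar>poly Q z\<bar> \<le> 5 * (real d)\<^sup>2 * B" if "a \<le> z" "z \<le> 1" for z
  proof -
    have "a * \<bar>poly Q z\<bar> \<le> z * \<bar>poly Q z\<bar>" using that by (intro mult_right_mono) auto
    also have "\<dots> \<le> B" using bound[of z] that a by (simp add: abs_mult)
    finally show ?thesis using d by (simp add: a_def field_simps)
  qed
  show ?thesis
  proof (cases "w < a")
    case True
    have "4 * (real d)\<^sup>2 * (a - w) \<le> 4 * (real d)\<^sup>2 * a"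
      using w by (intro mult_left_mono) auto
    also have "\<dots> = 4 / 5" using d by (simp add: a_def)
    also have "\<dots> \<le> 1 - a" using a by simp
    finally have "\<bar>poly Q w\<bar> \<le> 2 * (5 * (real d)\<^sup>2 * B)"
      using True a by (intro poly_extrapolate_left[OF deg _ far]) auto
    then show ?thesis by simp
  next
    case False
    have "0 \<le> (real d)\<^sup>2 * B" using B by simp
    with False w far[of w] show ?thesis by simp
  qed
qed

section \<open>Polynomial approximation of the square root\<close>

text \<open>
  The idea is to compare \<open>r\<close> with its own dilation. Since \<open>sqrt w = 2 * sqrt (w / 4)\<close>, the polynomial
  \<open>2 * r (w / 4) - r w\<close> is \<open>O(a)\<close> on \<open>[0, 1]\<close>, so its difference quotient at \<open>0\<close> is \<open>O(a d\<^sup>2)\<close>. If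
  \<open>r w = r 0 + w * r\<^sub>1 w\<close>, that quotient is \<open>r\<^sub>1 (w / 4) / 2 - r\<^sub>1 w\<close>; at a point where \<open>\<bar>r\<^sub>1\<bar>\<close> is
  maximal the first term can absorb at most half of the second, so \<open>r\<^sub>1\<close> itself is \<open>O(a d\<^sup>2)\<close>.
  A function with this Lipschitz bound at \<open>0\<close> cannot follow the steep rise of \<open>sqrt\<close> with a very small
  error \<open>\<eta>\<close>.
\<close>
lemma sqrt_approx_global_local:
  fixes r :: "real poly"
  assumes d: "d \<ge> 1" and deg: "degree r \<le> d"
    and global: "\<And>w. 0 \<le> w \<Longrightarrow> w \<le> 1 \<Longrightarrow> \<bar>poly r w - sqrt w\<bar> \<le> a"
    and local: "\<And>w. 0 \<le> w \<Longrightarrow> w \<le> 16 * \<eta>\<^sup>2 \<Longrightarrow> \<bar>poly r w - sqrt w\<bar> \<le> \<eta>"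
    and \<eta>: "\<eta> > 0" "16 * \<eta>\<^sup>2 \<le> 1"
  shows "1 \<le> 960 * a * (real d)\<^sup>2 * \<eta>"
proof -
  obtain c r1 where r: "r = pCons c r1" by (cases r)
  have deg1: "degree r1 \<le> d" using deg by (auto simp: r split: if_splits)
  define Q where "Q = smult (1 / 2) (pcompose r1 [:0, 1 / 4:]) - r1"
  have Q: "poly Q w = poly r1 (w / 4) / 2 - poly r1 w" for w
    by (simp add: Q_def poly_pcompose)
  have "degree Q \<le> d"
    unfolding Q_def using deg1 by (intro degree_diff_le) (auto simp: degree_pcompose)
  moreover have "\<bar>w * poly Q w\<bar> \<le> 6 * a" if w: "0 \<le> w" "w \<le> 1" for w
  proof -
    have "sqrt (w / 4) = sqrt w / 2" by (simp add: real_sqrt_divide)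
    moreover have "\<bar>poly r (w / 4) - sqrt (w / 4)\<bar> \<le> a" "\<bar>poly r w - sqrt w\<bar> \<le> a"
      "\<bar>poly r 0 - sqrt 0\<bar> \<le> a"
      using w by (intro global; simp)+
    moreover have "w * poly Q w = 2 * poly r (w / 4) - poly r w - poly r 0"
      by (simp add: Q r algebra_simps)
    ultimately show ?thesis by (simp only: abs_le_iff real_sqrt_zero) linarith
  qed
  ultimately have Q_le: "\<bar>poly Q w\<bar> \<le> 10 * (real d)\<^sup>2 * (6 * a)" if "0 \<le> w" "w \<le> 1" for w
    using d that by (intro poly_lipschitz_at_0[of d Q]) auto
  have "\<exists>w\<in>{0..1}. \<forall>z\<in>{0..1}. \<bar>poly r1 z\<bar> \<le> \<bar>poly r1 w\<bar>"
    by (intro continuous_attains_sup continuous_intros) auto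
  then obtain w where w: "0 \<le> w" "w \<le> 1"
    and wmax: "\<And>z. 0 \<le> z \<Longrightarrow> z \<le> 1 \<Longrightarrow> \<bar>poly r1 z\<bar> \<le> \<bar>poly r1 w\<bar>" by auto
  have "\<bar>poly r1 (w / 4)\<bar> \<le> \<bar>poly r1 w\<bar>" using w by (intro wmax) auto
  with Q_le[OF w] have "\<bar>poly r1 w\<bar> \<le> 120 * (real d)\<^sup>2 * a" by (simp add: Q)
  with wmax have r1: "\<bar>poly r1 z\<bar> \<le> 120 * (real d)\<^sup>2 * a" if "0 \<le> z" "z \<le> 1" for z
    using that by (meson order_trans)
  \<comment> \<open>At this point \<open>sqrt\<close> has risen by \<open>4 \<eta>\<close>, of which the error at the two ends can hide only \<open>2 \<eta>\<close>.\<close>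
  let ?h = "16 * \<eta>\<^sup>2"
  have "sqrt ?h = 4 * \<eta>" using \<eta> by (simp add: real_sqrt_mult)
  moreover have "\<bar>poly r ?h - sqrt ?h\<bar> \<le> \<eta>" "\<bar>poly r 0 - sqrt 0\<bar> \<le> \<eta>"
    by (intro local; simp)+
  moreover have "poly r ?h = poly r 0 + ?h * poly r1 ?h" by (simp add: r)
  ultimately have "2 * \<eta> \<le> ?h * poly r1 ?h" by (simp only: abs_le_iff real_sqrt_zero) linarith
  also have "\<dots> \<le> ?h * (120 * (real d)\<^sup>2 * a)"
    using r1[of ?h] \<eta> by (intro mult_left_mono) auto
  finally have "2 * \<eta> * 1 \<le> 2 * \<eta> * (960 * a * (real d)\<^sup>2 * \<eta>)"
    by (simp add: power2_eq_square algebra_simps)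
  then show ?thesis using \<eta> by (subst (asm) mult_le_cancel_left_pos) auto
qed

lemma poly_even_part:
  fixes p :: "real poly"
  assumes "degree p \<le> 2 * d"
  shows "\<exists>r. degree r \<le> d \<and> (\<forall>u. poly r (u\<^sup>2) = (poly p u + poly p (- u)) / 2)"
proof (intro exI conjI allI)
  let ?r = "\<Sum>i\<le>d. monom (coeff p (2 * i)) i"
  show "degree ?r \<le> d"
    by (intro degree_sum_le) (auto intro: order_trans[OF degree_monom_le])
  fix u :: real
  have p: "poly p v = (\<Sum>i\<le>2*d. coeff p i * v ^ i)" for v
    unfolding poly_altdef using assms
    by (intro sum.mono_neutral_left) (auto simp: coeff_eq_0)
  have "(poly p u + poly p (- u)) / 2 = (\<Sum>i\<le>2*d. if even i then coeff p i * u ^ i else 0)"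
    unfolding p sum.distrib[symmetric] sum_divide_distrib by (intro sum.cong) auto
  also have "\<dots> = (\<Sum>i\<in>(*) 2 ` {..d}. coeff p i * u ^ i)"
    by (subst sum.inter_filter[symmetric]) (auto intro!: sum.cong elim!: evenE)
  also have "\<dots> = (\<Sum>i\<le>d. coeff p (2 * i) * u ^ (2 * i))"
    by (subst sum.reindex) (auto simp: inj_on_def)
  finally show "poly ?r (u\<^sup>2) = (poly p u + poly p (- u)) / 2"
    by (simp add: poly_sum poly_monom power_mult)
qed

section \<open>Extrapolation along the diagonal\<close>

text \<open>
  Extrapolating the bound \<open>\<epsilon> sqrt s\<close> directly would give only \<open>O(\<epsilon> sqrt T) = O(\<epsilon> K V)\<close>. To use that the
  bound is smaller for small \<open>s\<close>, \<open>g\<close> is first multiplied by the Fejer-type kernel in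
  \<open>z = (s - 2) / (T - 2)\<close>, of degree at most \<open>K\<close>: it costs nothing at \<open>s = 2\<close>, and its decay
  \<open>1 / (K\<^sup>2 z)\<close> overcompensates the growth of \<open>sqrt s\<close>, so that the product is \<open>O(\<epsilon> V)\<close> on all of
  \<open>[V\<^sup>2, T]\<close>. The distance from \<open>2\<close> to \<open>V\<^sup>2\<close> is a small enough multiple of \<open>T/K\<^sup>2\<close> for degree \<open>3 K\<close>.
\<close>
lemma poly_weighted_extrapolate:
  fixes g :: "real poly"
  assumes K: "K \<ge> 1" and V: "V \<ge> 2" and T: "T = 64 * (real K)\<^sup>2 * V\<^sup>2"
    and deg: "degree g \<le> 2 * K"
    and bound: "\<And>s. V\<^sup>2 \<le> s \<Longrightarrow> s \<le> T \<Longrightarrow> \<bar>poly g s\<bar> \<le> \<epsilon> * sqrt s"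
  shows "\<bar>poly g 2\<bar> \<le> 256 * \<epsilon> * V"
proof -
  define k2 where "k2 = (real K)\<^sup>2"
  have k2: "k2 \<ge> 1" using K by (simp add: k2_def)
  have V2: "V\<^sup>2 \<ge> 4" using power_mono[OF V, of 2] by simp
  have TV: "T \<ge> 64 * V\<^sup>2"
    using mult_right_mono[OF k2, of "V\<^sup>2"] by (simp add: T k2_def)
  have \<epsilon>: "\<epsilon> \<ge> 0"
  proof -
    have "0 \<le> \<epsilon> * sqrt T" using bound[of T] TV V2 by force
    then show ?thesis using TV V2 by (simp add: zero_le_mult_iff)
  qed
  \<comment> \<open>Up to the factor \<open>- 2 K\<^sup>2\<close>, \<open>e\<close> is the kernel \<open>(1 - cheb K z) / (2 K\<^sup>2 z)\<close>.\<close>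
  obtain c e where ce: "cheb K = pCons c e" by (cases "cheb K")
  have c: "c = 1" using coeff_cheb_0[of K] by (simp add: ce)
  have e0: "poly e 0 = - 2 * k2"
    using coeff_cheb_1[of K] by (simp add: ce k2_def poly_0_coeff_0)
  have dege: "degree e \<le> K" using degree_cheb[of K] by (auto simp: ce split: if_splits)
  have e_le: "z * \<bar>poly e z\<bar> \<le> 2" if "0 \<le> z" "z \<le> 1" for z
    using abs_cheb_le_1[OF that, of K] that abs_mult[of z "poly e z"] by (simp add: ce c)
  define G where "G = g * pcompose e [:- 2 / (T - 2), 1 / (T - 2):]"
  have G: "poly G s = poly g s * poly e ((s - 2) / (T - 2))" for s
    by (simp add: G_def poly_pcompose diff_divide_distrib)
  have degG: "degree G \<le> 3 * K"
  proof -
    have "degree G \<le> degree g + degree (pcompose e [:- 2 / (T - 2), 1 / (T - 2):])"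
      unfolding G_def by (rule degree_mult_le)
    also have "\<dots> \<le> 2 * K + K"
      using deg dege by (intro add_mono) (auto simp: degree_pcompose)
    finally show ?thesis by simp
  qed
  have Gb: "\<bar>poly G s\<bar> \<le> 256 * \<epsilon> * k2 * V" if s: "V\<^sup>2 \<le> s" "s \<le> T" for s
  proof -
    define z where "z = (s - 2) / (T - 2)"
    have s4: "s \<ge> 4" using s V2 by simp
    have z: "0 < z" "z \<le> 1" using s s4 by (auto simp: z_def)
    have Vs: "V \<le> sqrt s" using s(1) by (rule real_le_rsqrt)
    have "(s / 2) / T \<le> z" unfolding z_def using s s4 by (intro frac_le) auto
    then have "s / (2 * T) * \<bar>poly e z\<bar> \<le> z * \<bar>poly e z\<bar>"
      by (intro mult_right_mono) auto
    also have "\<dots> \<le> 2" using z by (intro e_le) auto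
    finally have ez: "s * \<bar>poly e z\<bar> \<le> 4 * T"
      using s s4 by (simp add: field_simps)
    have "V * \<bar>poly G s\<bar> \<le> sqrt s * (\<bar>poly g s\<bar> * \<bar>poly e z\<bar>)"
      using Vs by (simp add: G abs_mult z_def mult_right_mono)
    also have "\<dots> \<le> sqrt s * ((\<epsilon> * sqrt s) * \<bar>poly e z\<bar>)"
      using bound[OF s] s4 by (intro mult_left_mono mult_right_mono) auto
    also have "\<dots> = \<epsilon> * (s * \<bar>poly e z\<bar>)" using s4 by simp
    also have "\<dots> \<le> \<epsilon> * (4 * T)" using ez \<epsilon> by (rule mult_left_mono)
    also have "\<dots> = V * (256 * \<epsilon> * k2 * V)" by (simp add: T k2_def power2_eq_square)
    finally show ?thesis using V by simp
  qed
  have "4 * (real (3 * K))\<^sup>2 * (V\<^sup>2 - 2) \<le> 36 * k2 * V\<^sup>2"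
    by (simp add: k2_def power_mult_distrib algebra_simps)
  also have "\<dots> \<le> T - V\<^sup>2"
    using mult_right_mono[OF k2, of "V\<^sup>2"] zero_le_power2[of V]
    unfolding T k2_def[symmetric] by linarith
  finally have "\<bar>poly G 2\<bar> \<le> 2 * (256 * \<epsilon> * k2 * V)"
    using TV V2 by (intro poly_extrapolate_left[OF degG _ Gb]) auto
  then have "2 * k2 * \<bar>poly g 2\<bar> \<le> 2 * k2 * (256 * \<epsilon> * V)"
    using k2 by (simp add: G e0 abs_mult algebra_simps)
  then show ?thesis using k2 by (simp add: mult_ac)
qed

text \<open>
  The contradiction in scaled coordinates, read off at \<open>s = 2\<close>: there \<open>\<bar>u\<bar>\<close> is approximated within \<open>2 \<epsilon>\<close> for
  \<open>\<bar>u\<bar> \<le> 1\<close> by hypothesis and within \<open>256 \<epsilon> V\<close> for \<open>\<bar>u\<bar> \<le> V\<close> by extrapolation. The constant is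
  \<open>960 * 256 * 2\<close>.
\<close>
lemma scaled_strip_obstruction:
  fixes F :: "real \<Rightarrow> real \<Rightarrow> real"
  assumes K: "K \<ge> 1" and V: "V \<ge> 2" and T: "T = 64 * (real K)\<^sup>2 * V\<^sup>2"
    and \<epsilon>: "0 < \<epsilon>" "8 * \<epsilon> \<le> 1"
    and poly_s: "\<And>u. \<exists>p. degree p \<le> 2 * K \<and> (\<forall>s. poly p s = F u s)"
    and poly_u: "\<And>s. \<exists>p. degree p \<le> 2 * K \<and> (\<forall>u. poly p u = F u s)"
    and approx: "\<And>u s. 1 < s \<Longrightarrow> s \<le> T \<Longrightarrow> u\<^sup>2 \<le> s \<Longrightarrow> \<bar>F u s - \<bar>u\<bar>\<bar> \<le> \<epsilon> * sqrt s"
  shows "V \<le> 491520 * (real K * \<epsilon>)\<^sup>2"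
proof -
  have V2: "V\<^sup>2 \<ge> 4" using power_mono[OF V, of 2] by simp
  have "(real K)\<^sup>2 \<ge> 1" using K by simp
  then have TV: "T \<ge> 64 * V\<^sup>2"
    using mult_right_mono[of 1 "(real K)\<^sup>2" "V\<^sup>2"] by (simp add: T)
  have wide: "\<bar>F u 2 - \<bar>u\<bar>\<bar> \<le> 256 * \<epsilon> * V" if u: "u\<^sup>2 \<le> V\<^sup>2" for u
  proof -
    obtain p where p: "degree p \<le> 2 * K" "\<And>s. poly p s = F u s" using poly_s by blast
    have "\<bar>poly (p - [:\<bar>u\<bar>:]) 2\<bar> \<le> 256 * \<epsilon> * V"
      using u p V2 by (intro poly_weighted_extrapolate[OF K V T])
        (auto intro!: degree_diff_le approx)
    then show ?thesis by (simp add: p)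
  qed
  have narrow: "\<bar>F u 2 - \<bar>u\<bar>\<bar> \<le> 2 * \<epsilon>" if u: "u\<^sup>2 \<le> 1" for u
  proof -
    have "sqrt 2 \<le> sqrt (2\<^sup>2)" by (intro real_sqrt_le_mono) simp
    then have "\<epsilon> * sqrt 2 \<le> \<epsilon> * 2" using \<epsilon> by (intro mult_left_mono) auto
    with approx[of 2 u] TV V2 u show ?thesis by simp
  qed
  obtain p where p: "degree p \<le> 2 * K" "\<And>u. poly p u = F u 2" using poly_u by blast
  \<comment> \<open>Averaging over \<open>u\<close> and \<open>- u\<close> preserves both error bounds because \<open>\<bar>u\<bar>\<close> is even.\<close>
  obtain q where q: "degree q \<le> K" "\<And>u. poly q (u\<^sup>2) = (F u 2 + F (- u) 2) / 2"
    using poly_even_part[OF p(1)] p(2) by metis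
  define r where "r = smult (1 / V) (pcompose q [:0, V\<^sup>2:])"
  have degr: "degree r \<le> K" using q V by (simp add: r_def degree_pcompose)
  have r: "\<bar>poly r w - sqrt w\<bar> \<le> b / V"
    if w: "w \<ge> 0" and b: "\<And>u. u\<^sup>2 = V\<^sup>2 * w \<Longrightarrow> \<bar>F u 2 - \<bar>u\<bar>\<bar> \<le> b" for w b
  proof -
    let ?u = "V * sqrt w"
    have u2: "?u\<^sup>2 = V\<^sup>2 * w" using w by (simp add: power_mult_distrib)
    have "\<bar>?u\<bar> = ?u" using V w by simp
    then have "\<bar>F ?u 2 - ?u\<bar> \<le> b" "\<bar>F (- ?u) 2 - ?u\<bar> \<le> b"
      using b[of ?u] b[of "- ?u"] u2 by simp_all
    moreover have "poly q (V\<^sup>2 * w) = (F ?u 2 + F (- ?u) 2) / 2"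
      unfolding u2[symmetric] by (rule q(2))
    ultimately have "\<bar>poly q (V\<^sup>2 * w) - ?u\<bar> \<le> b"
      by (auto simp: abs_le_iff field_simps)
    moreover have "poly r w - sqrt w = (poly q (V\<^sup>2 * w) - ?u) / V"
      using V by (simp add: r_def poly_pcompose field_simps)
    ultimately show ?thesis using V by (simp add: abs_divide divide_right_mono)
  qed
  have \<epsilon>2: "64 * \<epsilon>\<^sup>2 \<le> 1"
    using power_mono[OF \<epsilon>(2), of 2] \<epsilon> by (simp add: power_mult_distrib)
  have "1 \<le> 960 * (256 * \<epsilon> * V / V) * (real K)\<^sup>2 * (2 * \<epsilon> / V)"
  proof (rule sqrt_approx_global_local[OF K degr])
    show "\<bar>poly r w - sqrt w\<bar> \<le> 256 * \<epsilon> * V / V" if "0 \<le> w" "w \<le> 1" for w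
      using that mult_left_mono[of w 1 "V\<^sup>2"] by (intro r wide) auto
    show "\<bar>poly r w - sqrt w\<bar> \<le> 2 * \<epsilon> / V" if w: "0 \<le> w" "w \<le> 16 * (2 * \<epsilon> / V)\<^sup>2" for w
    proof -
      have "V\<^sup>2 * w \<le> V\<^sup>2 * (16 * (2 * \<epsilon> / V)\<^sup>2)" using w by (intro mult_left_mono) auto
      also have "\<dots> = 64 * \<epsilon>\<^sup>2" using V by (simp add: power_divide power_mult_distrib)
      finally show ?thesis using \<epsilon>2 w by (intro r narrow) auto
    qed
    have "16 * (2 * \<epsilon> / V)\<^sup>2 = 64 * \<epsilon>\<^sup>2 / V\<^sup>2"
      by (simp add: power_divide power_mult_distrib)
    also have "\<dots> \<le> 1" using \<epsilon>2 V2 by (subst divide_le_eq_1_pos) auto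
    finally show "16 * (2 * \<epsilon> / V)\<^sup>2 \<le> 1" .
  qed (use \<epsilon> V in auto)
  then have "V * 1 \<le> V * (960 * (256 * \<epsilon> * V / V) * (real K)\<^sup>2 * (2 * \<epsilon> / V))"
    using V by (intro mult_left_mono) auto
  also have "\<dots> = 491520 * (real K * \<epsilon>)\<^sup>2"
    using V by (simp add: power_mult_distrib power2_eq_square)
  finally show ?thesis by simp
qed

section \<open>Scaling back\<close>

lemma poly2_upto_on_line:
  assumes "P \<in> poly2_upto K"
  shows "\<exists>p. degree p \<le> 2 * K \<and> (\<forall>s. poly p s = P (a + b * s) (c + d * s))"
proof -
  obtain m where P: "P = (\<lambda>x y. \<Sum>i\<le>K. \<Sum>j\<le>K. m i j * x ^ i * y ^ j)"
    using assms by (auto simp: poly2_upto_def)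
  let ?p = "\<Sum>i\<le>K. \<Sum>j\<le>K. smult (m i j) ([:a, b:] ^ i * [:c, d:] ^ j)"
  have "degree (smult (m i j) ([:a, b:] ^ i * [:c, d:] ^ j)) \<le> 2 * K"
    if "i \<le> K" "j \<le> K" for i j
  proof -
    have "degree ([:a, b:] ^ i) \<le> i" "degree ([:c, d:] ^ j) \<le> j"
      using degree_power_le[of "[:a, b:]" i] degree_power_le[of "[:c, d:]" j]
      by (auto split: if_splits)
    with that degree_mult_le[of "[:a, b:] ^ i" "[:c, d:] ^ j"]
      degree_smult_le[of "m i j" "[:a, b:] ^ i * [:c, d:] ^ j"]
    show ?thesis by linarith
  qed
  then have "degree ?p \<le> 2 * K" by (intro degree_sum_le) auto
  moreover have "poly ?p s = P (a + b * s) (c + d * s)" for s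
    by (simp add: P poly_sum algebra_simps)
  ultimately show ?thesis by blast
qed

text \<open>
  The square attached to \<open>q = \<Delta> s\<close> has half-width \<open>sqrt (\<Delta> q) = \<Delta> sqrt s\<close>. Excluding \<open>s = 1\<close> keeps \<open>q\<close> in the
  second branch of the definition of \<open>U\<close>.
\<close>
lemma U'_contains_parabola:
  assumes \<Delta>: "\<Delta> = c1 * ln (real n) / real n" "\<Delta> > 0"
    and "1 < s" "\<Delta> * s \<le> t" "u\<^sup>2 \<le> s"
  shows "(\<Delta> * s + \<Delta> * u, \<Delta> * s - \<Delta> * u) \<in> U' n c1 t"
proof -
  have "\<Delta> * 1 < \<Delta> * s" using assms by (intro mult_strict_left_mono) auto
  then have s: "\<Delta> < \<Delta> * s" by simp
  have "c1 * (\<Delta> * s) * ln (real n) / real n = \<Delta>\<^sup>2 * s"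
    by (simp add: \<Delta>(1) power2_eq_square)
  then have U: "U n c1 (\<Delta> * s) = {\<Delta> * s - \<Delta> * sqrt s .. \<Delta> * s + \<Delta> * sqrt s}"
    using s \<Delta>(2) by (simp add: U_def flip: \<Delta>(1)) (simp add: real_sqrt_mult)
  have "\<bar>u\<bar> \<le> sqrt s" using assms by (intro real_le_rsqrt) simp
  then have "\<Delta> * \<bar>u\<bar> \<le> \<Delta> * sqrt s" using \<Delta>(2) by simp
  moreover have "\<Delta> * u \<le> \<Delta> * \<bar>u\<bar>" "\<Delta> * (- u) \<le> \<Delta> * \<bar>u\<bar>"
    using \<Delta>(2) by (intro mult_left_mono; simp)+
  ultimately have "(\<Delta> * s + \<Delta> * u, \<Delta> * s - \<Delta> * u) \<in> U n c1 (\<Delta> * s) \<times> U n c1 (\<Delta> * s)"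
    unfolding U by simp
  moreover have "\<Delta> * s \<in> {\<Delta>..t}" using s assms by simp
  ultimately show ?thesis unfolding U'_def \<Delta>(1)[symmetric] by blast
qed

text \<open>
  The factor \<open>1 / sqrt (2 \<Delta>)\<close> arises because the weight is \<open>sqrt (x + y) = sqrt (2 \<Delta>) sqrt s\<close> while
  \<open>F\<close> is scaled by \<open>1 / (2 \<Delta>)\<close>.
\<close>
lemma weighted_approx_error_lower_bound:
  fixes c1 t e :: real
  assumes \<Delta>: "\<Delta> = c1 * ln (real n) / real n" "\<Delta> > 0"
    and K: "K \<ge> 1" and e: "0 < e" "8 * (e / sqrt (2 * \<Delta>)) \<le> 1"
    and V: "V \<ge> 2" "64 * (real K)\<^sup>2 * V\<^sup>2 * \<Delta> \<le> t"
      "491520 * (real K * (e / sqrt (2 * \<Delta>)))\<^sup>2 < V"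
    and P: "P \<in> poly2_upto K"
  shows "ereal e \<le> weighted_approx_error (U' n c1 t) P"
proof (rule ccontr)
  assume "\<not> ?thesis"
  then have less: "weighted_approx_error (U' n c1 t) P < ereal e" by simp
  define \<epsilon> where "\<epsilon> = e / sqrt (2 * \<Delta>)"
  define T where "T = 64 * (real K)\<^sup>2 * V\<^sup>2"
  define F where "F u s = P (\<Delta> * s + \<Delta> * u) (\<Delta> * s - \<Delta> * u) / (2 * \<Delta>)" for u s
  have "V \<le> 491520 * (real K * \<epsilon>)\<^sup>2"
  proof (rule scaled_strip_obstruction[OF K V(1) T_def])
    show "0 < \<epsilon>" "8 * \<epsilon> \<le> 1" using e \<Delta>(2) by (auto simp: \<epsilon>_def)
    show "\<exists>p. degree p \<le> 2 * K \<and> (\<forall>s. poly p s = F u s)" for u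
    proof -
      obtain p where p: "degree p \<le> 2 * K"
        "\<And>s. poly p s = P (\<Delta> * u + \<Delta> * s) (- \<Delta> * u + \<Delta> * s)"
        using poly2_upto_on_line[OF P] by metis
      then show ?thesis
        by (intro exI[of _ "smult (1 / (2 * \<Delta>)) p"]) (simp add: F_def add.commute)
    qed
    show "\<exists>p. degree p \<le> 2 * K \<and> (\<forall>u. poly p u = F u s)" for s
    proof -
      obtain p where p: "degree p \<le> 2 * K"
        "\<And>u. poly p u = P (\<Delta> * s + \<Delta> * u) (\<Delta> * s + (- \<Delta>) * u)"
        using poly2_upto_on_line[OF P] by metis
      then show ?thesis
        by (intro exI[of _ "smult (1 / (2 * \<Delta>)) p"]) (simp add: F_def)
    qed
    fix u s :: real
    assume s: "1 < s" "s \<le> T" "u\<^sup>2 \<le> s"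
    let ?x = "\<Delta> * s + \<Delta> * u" and ?y = "\<Delta> * s - \<Delta> * u"
    have "\<Delta> * s \<le> \<Delta> * T" using s \<Delta>(2) by simp
    then have "\<Delta> * s \<le> t" using V(2) by (simp add: T_def mult_ac)
    with s have "(?x, ?y) \<in> U' n c1 t" by (intro U'_contains_parabola \<Delta>) auto
    moreover have sum: "?x + ?y = 2 * \<Delta> * s" by simp
    moreover have pos: "2 * \<Delta> * s > 0" using s \<Delta>(2) by simp
    ultimately have "ereal (\<bar>P ?x ?y - \<bar>?x - ?y\<bar>\<bar> / sqrt (?x + ?y))
        \<le> weighted_approx_error (U' n c1 t) P"
      unfolding weighted_approx_error_def by (intro SUP_upper2[of "(?x, ?y)"]) auto
    with less have "ereal (\<bar>P ?x ?y - \<bar>?x - ?y\<bar>\<bar> / sqrt (?x + ?y)) < ereal e"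
      by (rule le_less_trans[rotated])
    then have "\<bar>P ?x ?y - \<bar>?x - ?y\<bar>\<bar> < e * sqrt (2 * \<Delta> * s)"
      using pos unfolding sum by (simp add: pos_divide_less_eq)
    moreover have "P ?x ?y - \<bar>?x - ?y\<bar> = 2 * \<Delta> * (F u s - \<bar>u\<bar>)"
      using \<Delta>(2) by (simp add: F_def right_diff_distrib abs_mult)
    ultimately have "2 * \<Delta> * \<bar>F u s - \<bar>u\<bar>\<bar> < e * sqrt (2 * \<Delta> * s)"
      using \<Delta>(2) by (simp add: abs_mult)
    also have "e * sqrt (2 * \<Delta> * s) = 2 * \<Delta> * (\<epsilon> * sqrt s)"
    proof -
      have "2 * \<Delta> = sqrt (2 * \<Delta>) * sqrt (2 * \<Delta>)" using \<Delta>(2) by simp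
      then show ?thesis unfolding \<epsilon>_def real_sqrt_mult[of "2 * \<Delta>" s] using \<Delta>(2)
        by (simp add: field_simps)
    qed
    finally show "\<bar>F u s - \<bar>u\<bar>\<bar> \<le> \<epsilon> * sqrt s" using \<Delta>(2) by simp
  qed
  with V(3) show False by (simp add: \<epsilon>_def)
qed

theorem lemma7:
  fixes c1 :: real and t :: "nat \<Rightarrow> real" and K :: "nat \<Rightarrow> nat"
  assumes "c1 > 0"
    and "\<And>n. n \<ge> 1 \<Longrightarrow> t n \<le> 1 / 2"
    and "filterlim (\<lambda>n. t n / (ln (real n) ^ 3 / real n)) at_top sequentially"
    and "(\<lambda>n. real (K n)) \<in> \<Theta>(\<lambda>n. ln (real n))"
  shows "liminf (\<lambda>n. ereal (sqrt (real n * ln (real n))) *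
           (INF P \<in> poly2_upto (K n). weighted_approx_error (U' n c1 (t n)) P)) = \<infinity>"
proof -
  let ?L = "\<lambda>n. ln (real n)"
  let ?f = "\<lambda>n. ereal (sqrt (real n * ?L n)) *
    (INF P \<in> poly2_upto (K n). weighted_approx_error (U' n c1 (t n)) P)"
  have L_top: "filterlim ?L at_top sequentially"
    by (rule filterlim_compose[OF ln_at_top filterlim_real_sequentially])
  obtain b where b: "b > 0" "eventually (\<lambda>n. norm (real (K n)) \<le> b * norm (?L n)) sequentially"
    using assms(4) by (auto dest!: bigthetaD1 elim!: landau_o.bigE)
  obtain a where a: "a > 0" "eventually (\<lambda>n. norm (real (K n)) \<ge> a * norm (?L n)) sequentially"
    using assms(4) by (auto dest!: bigthetaD2 elim!: landau_omega.bigE)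
  have "eventually (\<lambda>n. ereal M \<le> ?f n) sequentially" if "M > 0" for M
  proof -
    \<comment> \<open>Since \<open>K \<epsilon> \<le> b M / sqrt (2 c\<^sub>1)\<close>, this fixed \<open>V\<close> already contradicts \<open>scaled_strip_obstruction\<close>. Only
      the part \<open>s \<le> 64 K\<^sup>2 V\<^sup>2\<close> of the region is then used, and it is available
      as soon as \<open>t n\<close> exceeds the corresponding multiple of \<open>(ln n)\<^sup>3 / n\<close>.\<close>
    define V where "V = 2 + 491520 * (b * M)\<^sup>2 / (2 * c1)"
    have V: "V \<ge> 2" using assms(1) by (simp add: V_def)
    have "eventually (\<lambda>n. n \<ge> 1) sequentially" by (rule eventually_ge_at_top)
    moreover have "eventually (\<lambda>n. ?L n > 0) sequentially"
      using L_top unfolding filterlim_at_top_dense by blast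
    moreover have "eventually (\<lambda>n. ?L n \<ge> 1 / a) sequentially"
      "eventually (\<lambda>n. ?L n \<ge> 8 * M / sqrt (2 * c1)) sequentially"
      using L_top unfolding filterlim_at_top by blast+
    moreover have "eventually (\<lambda>n. t n / (?L n ^ 3 / real n) \<ge> 64 * b\<^sup>2 * V\<^sup>2 * c1) sequentially"
      using assms(3) by (auto simp: filterlim_at_top)
    ultimately show ?thesis using a(2) b(2)
    proof eventually_elim
      case (elim n)
      define \<Delta> where "\<Delta> = c1 * ?L n / real n"
      define e where "e = M / sqrt (real n * ?L n)"
      have n: "real n > 0" using elim by simp
      have \<Delta>: "\<Delta> > 0" using n elim assms(1) by (simp add: \<Delta>_def)
      have e: "e > 0" using \<open>M > 0\<close> n elim by (simp add: e_def)
      have Kb: "real (K n) \<le> b * ?L n" and Ka: "a * ?L n \<le> real (K n)" using elim by auto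
      have "1 \<le> a * ?L n" using elim a(1) by (simp add: field_simps)
      then have K1: "K n \<ge> 1" using Ka by linarith
      have "sqrt (real n * ?L n) * sqrt (2 * \<Delta>) = sqrt (2 * c1 * (?L n)\<^sup>2)"
        using n by (simp add: \<Delta>_def power2_eq_square flip: real_sqrt_mult)
      also have "\<dots> = sqrt (2 * c1) * ?L n" using elim by (simp add: real_sqrt_mult)
      finally have \<epsilon>: "e / sqrt (2 * \<Delta>) = M / (sqrt (2 * c1) * ?L n)"
        by (simp add: e_def)
      have e8: "8 * (e / sqrt (2 * \<Delta>)) \<le> 1"
        unfolding \<epsilon> using elim assms(1) by (simp add: field_simps)
      have "(real (K n) * (e / sqrt (2 * \<Delta>)))\<^sup>2
          = (real (K n))\<^sup>2 * M\<^sup>2 / (2 * c1 * (?L n)\<^sup>2)"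
        unfolding \<epsilon> using assms(1) by (simp add: power_mult_distrib power_divide)
      also have "\<dots> \<le> (b * ?L n)\<^sup>2 * M\<^sup>2 / (2 * c1 * (?L n)\<^sup>2)"
        using Kb assms(1) by (intro divide_right_mono mult_right_mono power_mono) auto
      also have "\<dots> = (b * M)\<^sup>2 / (2 * c1)"
        using elim by (simp add: power_mult_distrib)
      finally have KV: "491520 * (real (K n) * (e / sqrt (2 * \<Delta>)))\<^sup>2 < V"
        by (simp add: V_def)
      have "64 * (real (K n))\<^sup>2 * V\<^sup>2 * \<Delta> \<le> 64 * (b * ?L n)\<^sup>2 * V\<^sup>2 * \<Delta>"
        using Kb \<Delta> by (intro mult_right_mono mult_left_mono power_mono) auto
      also have "\<dots> = (64 * b\<^sup>2 * V\<^sup>2 * c1) * (?L n ^ 3 / real n)"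
        by (simp add: \<Delta>_def power_mult_distrib power2_eq_square power3_eq_cube)
      also have "\<dots> \<le> t n"
      proof -
        have "?L n ^ 3 / real n > 0" using elim n by simp
        with elim show ?thesis by (simp only: pos_le_divide_eq)
      qed
      finally have "ereal e \<le> weighted_approx_error (U' n c1 (t n)) P"
        if "P \<in> poly2_upto (K n)" for P
        using that by (intro weighted_approx_error_lower_bound[OF \<Delta>_def \<Delta> K1 e e8 V _ KV])
      then have "ereal e \<le> (INF P \<in> poly2_upto (K n). weighted_approx_error (U' n c1 (t n)) P)"
        by (rule INF_greatest)
      then have "ereal (sqrt (real n * ?L n)) * ereal e \<le> ?f n"
        using elim by (intro ereal_mult_left_mono) auto
      moreover have "sqrt (real n * ?L n) * e = M" using n elim by (simp add: e_def)
      ultimately show ?case by simp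
    qed
  qed
  then have M: "ereal M \<le> liminf ?f" if "M > 0" for M
    using that by (intro Liminf_bounded) auto
  show ?thesis
  proof (rule ereal_top)
    fix B
    show "ereal B \<le> liminf ?f"
      using M[of "max B 1"] by (rule order_trans[rotated]) auto
  qed
qed

end
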